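(* Let $A,B,H,K$ be any logically independent events. The probability assessment $\mathcal{P}=(x,y,z)$ on the family of conditional events $\mathcal{F}=\{A|H,\ B|K,\ (B|K)|_{dF}(A|H)\}$ is coherent for every $(x,y,z)\in[0,1]^3$.
   Context: Events are two-valued entities (true/false), identified with their indicators (values $1/0$). $\emptyset$ is the impossible event; $AB$ denotes $A\wedge B$; $\overline{A}$ is the negation of $A$. Four events are logically independent if all $16$ conjunctions obtained by taking each event or its negation are different from $\emptyset$. For events $E,H$ with $H\neq\emptyset$, the conditional event $E|H$ is true if $EH$ is true, false if $\overline{E}H$ is true, void if $\overline{H}$ is true. Coherence: a real vector $\mathcal{P}=(p_1,\dots,p_n)$, with $p_j=P(E_j|H_j)$, on $\mathcal{F}=\{E_1|H_1,\dots,E_n|H_n\}$ is coherent iff for every nonempty $J\subseteq\{1,\dots,n\}$ and all real numbers $s_j$ ($j\in J$), the random gain $G=\sum_{j\in J}s_jH_j(E_j-p_j)$, restricted to the cases where $\bigvee_{j\in J}H_j$ is true, satisfies $\min G\le 0\le\max G$. De Finetti iterated conditional: $(B|K)|_{dF}(A|H)=B|(AHK)$ (a conditional event). *)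

theory Defs
  imports Complex_Main "HOL-Library.Indicator_Function"
begin

text \<open>
  Events are sets of possible worlds: conjunction is intersection, negation is complement and
  the impossible event is the empty set.
\<close>

definition logically_independent ::
  "'w set \<Rightarrow> 'w set \<Rightarrow> 'w set \<Rightarrow> 'w set \<Rightarrow> bool" where
  "logically_independent A B H K \<longleftrightarrow>
     (\<forall>A' \<in> {A, - A}. \<forall>B' \<in> {B, - B}. \<forall>H' \<in> {H, - H}. \<forall>K' \<in> {K, - K}.
        A' \<inter> B' \<inter> H' \<inter> K' \<noteq> {})"

text \<open>
  \<open>E |\<^sub>c H\<close> is true on \<open>E \<inter> H\<close>, false on \<open>- E \<inter> H\<close> and void on \<open>- H\<close>.  The side condition
  \<open>H \<noteq> {}\<close> is not built into the type; it is imposed on every member of the family in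
  \<open>coherent\<close>.
\<close>

datatype 'w cond_event =
  Cond (event: "'w set") (given: "'w set")  (infix \<open>|\<^sub>c\<close> 55)

fun dF_iterated :: "'w cond_event \<Rightarrow> 'w cond_event \<Rightarrow> 'w cond_event"  (infix \<open>|\<^sub>d\<^sub>F\<close> 54) where
  "(B |\<^sub>c K) |\<^sub>d\<^sub>F (A |\<^sub>c H) = B |\<^sub>c (A \<inter> H \<inter> K)"

definition gain ::
  "'w cond_event list \<Rightarrow> real list \<Rightarrow> nat set \<Rightarrow> (nat \<Rightarrow> real) \<Rightarrow> 'w \<Rightarrow> real" where
  "gain F P J s w =
     (\<Sum>j\<in>J. s j * indicator (given (F ! j)) w * (indicator (event (F ! j)) w - P ! j))"

text \<open>
  The gain takes finitely many values, so the \<open>Min\<close> and \<open>Max\<close> in the definition of coherence are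
  taken over finite sets, which are nonempty because the conditioning events are.
\<close>

lemma finite_gain_image:
  assumes "finite J"
  shows "finite (gain F P J s ` S)"
proof -
  let ?g = "\<lambda>(X, Y). \<Sum>j\<in>J. s j * of_bool (j \<in> X) * (of_bool (j \<in> Y) - P ! j)"
  have "gain F P J s w \<in> ?g ` (Pow J \<times> Pow J)" for w
  proof (rule image_eqI)
    show "gain F P J s w = ?g ({j \<in> J. w \<in> given (F ! j)}, {j \<in> J. w \<in> event (F ! j)})"
      unfolding gain_def by (auto intro!: sum.cong simp: indicator_def)
  qed auto
  then have "gain F P J s ` S \<subseteq> ?g ` (Pow J \<times> Pow J)"
    by blast
  then show ?thesis
    using assms by (meson finite_Pow_iff finite_SigmaI finite_imageI finite_subset)
qed

definition coherent :: "'w cond_event list \<Rightarrow> real list \<Rightarrow> bool" where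
  "coherent F P \<longleftrightarrow>
     length P = length F \<and> (\<forall>C \<in> set F. given C \<noteq> {}) \<and>
     (\<forall>J s. J \<noteq> {} \<and> J \<subseteq> {..<length F} \<longrightarrow>
        (let G = gain F P J s ` (\<Union>j\<in>J. given (F ! j))
         in Min G \<le> 0 \<and> 0 \<le> Max G))"

end

theory Submission
  imports Defs
begin

text \<open>
  A gain on a subfamily is easy to control in a world where a single conditional event of the
  subfamily is not void: it reduces to one stake \<open>s (E - p)\<close>, and since \<open>p\<close> lies between the two
  values of \<open>E\<close>, one truth value of \<open>E\<close> makes it nonnegative and the other nonpositive.
  Hence every assessment with values in the unit interval is coherent as soon as each
  subfamily has a member that can be both true and false while all other members are void
  (\<open>coherent_if_isolated\<close>).

  Logical independence provides such members: \<open>A |\<^sub>c H\<close> can be isolated by making \<open>K\<close> false,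
  because the iterated conditional is then void as well, and \<open>B |\<^sub>c K\<close> by making \<open>H\<close> false.
  A subfamily with neither of them consists of the iterated conditional alone, which can be
  true and false because \<open>B\<close> is undecided on \<open>A \<inter> H \<inter> K\<close>.
\<close>

lemma gain_uminus: "gain F P J (\<lambda>j. - s j) w = - gain F P J s w"
  by (simp add: gain_def sum_negf)

lemma gain_isolated:
  assumes "finite J" "j \<in> J" "w \<in> given (F ! j)"
    and "\<And>i. i \<in> J - {j} \<Longrightarrow> w \<notin> given (F ! i)"
  shows "gain F P J s w = s j * (indicator (event (F ! j)) w - P ! j)"
proof -
  have "gain F P J s w =
      (\<Sum>i\<in>{j}. s i * indicator (given (F ! i)) w * (indicator (event (F ! i)) w - P ! i))"
    unfolding gain_def using assms by (intro sum.mono_neutral_right) auto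
  then show ?thesis
    using assms(3) by simp
qed

text \<open>
  Changing the sign of all stakes negates every gain, so only the upper half of the coherence
  condition has to be verified, by exhibiting a world of nonnegative gain for every choice of
  stakes.
\<close>

lemma coherent_if_nonneg_gain:
  assumes "length P = length F" and "\<And>C. C \<in> set F \<Longrightarrow> given C \<noteq> {}"
    and nonneg: "\<And>J s. J \<noteq> {} \<Longrightarrow> J \<subseteq> {..<length F} \<Longrightarrow>
      \<exists>w \<in> (\<Union>j\<in>J. given (F ! j)). 0 \<le> gain F P J s w"
  shows "coherent F P"
proof -
  have "Min (gain F P J s ` S) \<le> 0 \<and> 0 \<le> Max (gain F P J s ` S)"
    if J: "J \<noteq> {}" "J \<subseteq> {..<length F}" and S: "S = (\<Union>j\<in>J. given (F ! j))" for J s S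
  proof -
    have fin: "finite (gain F P J s ` S)"
      using J(2) by (intro finite_gain_image) (rule finite_subset, auto)
    obtain u where "u \<in> S" "0 \<le> gain F P J s u"
      using nonneg[OF J] S by blast
    moreover obtain v where "v \<in> S" "gain F P J s v \<le> 0"
      using nonneg[OF J, of "\<lambda>j. - s j"] S by (auto simp: gain_uminus)
    ultimately show ?thesis
      using fin by (meson Max_ge Min_le imageI order_trans)
  qed
  then show ?thesis
    using assms(1,2) by (simp add: coherent_def Let_def)
qed

text \<open>
  If \<open>j\<close> is isolated in \<open>J\<close>, the truth value of its event is chosen according to the sign of the
  stake \<open>s j\<close>. Isolation within the singletons \<open>J = {j}\<close> guarantees that no conditioning event
  is impossible.
\<close>

lemma coherent_if_isolated:
  assumes len: "length P = length F" and P: "set P \<subseteq> {0..1}"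
    and isolated: "\<And>J. J \<noteq> {} \<Longrightarrow> J \<subseteq> {..<length F} \<Longrightarrow>
      \<exists>j\<in>J. \<forall>E \<in> {event (F ! j), - event (F ! j)}.
        E \<inter> given (F ! j) - (\<Union>i\<in>J - {j}. given (F ! i)) \<noteq> {}"
  shows "coherent F P"
proof (rule coherent_if_nonneg_gain[OF len])
  fix C assume "C \<in> set F"
  then obtain j where "j < length F" "C = F ! j"
    by (auto simp: in_set_conv_nth)
  then show "given C \<noteq> {}"
    using isolated[of "{j}"] by auto
next
  fix J and s :: "nat \<Rightarrow> real" assume J: "J \<noteq> {}" "J \<subseteq> {..<length F}"
  obtain j where j: "j \<in> J"
    and E: "\<forall>E \<in> {event (F ! j), - event (F ! j)}.
      E \<inter> given (F ! j) - (\<Union>i\<in>J - {j}. given (F ! i)) \<noteq> {}"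
    using isolated[OF J] by (rule bexE)
  have "j < length P"
    using J(2) j len by auto
  then have "P ! j \<in> {0..1}"
    by (intro subsetD[OF P] nth_mem)
  then have p: "0 \<le> P ! j" "P ! j \<le> 1"
    by auto
  let ?E = "if 0 \<le> s j then event (F ! j) else - event (F ! j)"
  have "?E \<inter> given (F ! j) - (\<Union>i\<in>J - {j}. given (F ! i)) \<noteq> {}"
    by (rule bspec[OF E]) simp
  then obtain w where w: "w \<in> ?E" "w \<in> given (F ! j)" "\<And>i. i \<in> J - {j} \<Longrightarrow> w \<notin> given (F ! i)"
    by blast
  have "finite J"
    using J(2) by (rule finite_subset) simp
  then have "gain F P J s w = s j * (indicator (event (F ! j)) w - P ! j)"
    using j w(2,3) by (rule gain_isolated)
  also have "0 \<le> \<dots>"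
    using p w(1) by (auto simp: mult_nonpos_nonneg split: if_splits)
  finally show "\<exists>w \<in> (\<Union>j\<in>J. given (F ! j)). 0 \<le> gain F P J s w"
    using j w(2) by blast
qed

theorem theorem7:
  fixes A B H K :: "'w set" and x y z :: real
  assumes "logically_independent A B H K"
    and "x \<in> {0..1}" and "y \<in> {0..1}" and "z \<in> {0..1}"
  shows "coherent [A |\<^sub>c H, B |\<^sub>c K, (B |\<^sub>c K) |\<^sub>d\<^sub>F (A |\<^sub>c H)] [x, y, z]"
proof (rule coherent_if_isolated)
  let ?F = "[A |\<^sub>c H, B |\<^sub>c K, (B |\<^sub>c K) |\<^sub>d\<^sub>F (A |\<^sub>c H)]"
  show "length [x, y, z] = length ?F" "set [x, y, z] \<subseteq> {0..1}"
    using assms(2-4) by auto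
  fix J :: "nat set" assume J: "J \<noteq> {}" "J \<subseteq> {..<length ?F}"
  have third: "i = 2" if "i \<in> J" "i \<noteq> 0" "i \<noteq> 1" for i
  proof -
    have "i < 3"
      using subsetD[OF J(2) that(1)] by simp
    with that(2,3) show ?thesis
      by linarith
  qed
  have possible: "A' \<inter> B' \<inter> H' \<inter> K' \<noteq> {}"
    if "A' \<in> {A, - A}" "B' \<in> {B, - B}" "H' \<in> {H, - H}" "K' \<in> {K, - K}" for A' B' H' K'
    using assms(1)[unfolded logically_independent_def, rule_format, OF that] .
  have AH: "E \<inter> H - K \<noteq> {}" if "E \<in> {A, - A}" for E
    using possible[OF that, of B H "- K"] by auto
  have BK: "E \<inter> K - H \<noteq> {}" if "E \<in> {B, - B}" for E
    using possible[OF _ that, of A "- H" K] by auto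
  have BAHK: "E \<inter> (A \<inter> H \<inter> K) \<noteq> {}" if "E \<in> {B, - B}" for E
    using possible[OF _ that, of A H K] by auto
  let ?isolated = "\<lambda>j. \<forall>E \<in> {event (?F ! j), - event (?F ! j)}.
    E \<inter> given (?F ! j) - (\<Union>i\<in>J - {j}. given (?F ! i)) \<noteq> {}"
  show "\<exists>j\<in>J. ?isolated j"
  proof (cases "0 \<in> J")
    case True
    have void: "(\<Union>i\<in>J - {0}. given (?F ! i)) \<subseteq> K"
    proof (rule UN_least)
      fix i assume "i \<in> J - {0}"
      then show "given (?F ! i) \<subseteq> K"
        using third[of i] by (cases "i = 1") auto
    qed
    have "?isolated 0"
    proof
      fix E assume "E \<in> {event (?F ! 0), - event (?F ! 0)}"
      then have "E \<inter> H - K \<noteq> {}"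
        by (intro AH) simp
      with void show "E \<inter> given (?F ! 0) - (\<Union>i\<in>J - {0}. given (?F ! i)) \<noteq> {}"
        unfolding nth_Cons_0 cond_event.sel by blast
    qed
    with True show ?thesis ..
  next
    case zero: False
    show ?thesis
    proof (cases "1 \<in> J")
      case True
      have void: "(\<Union>i\<in>J - {1}. given (?F ! i)) \<subseteq> H"
      proof (rule UN_least)
        fix i assume "i \<in> J - {1}"
        then show "given (?F ! i) \<subseteq> H"
          using third[of i] zero by (cases "i = 0") auto
      qed
      have second: "?F ! 1 = B |\<^sub>c K"
        by simp
      have "?isolated 1"
      proof
        fix E assume "E \<in> {event (?F ! 1), - event (?F ! 1)}"
        then have "E \<inter> K - H \<noteq> {}"
          by (intro BK) simp
        with void show "E \<inter> given (?F ! 1) - (\<Union>i\<in>J - {1}. given (?F ! i)) \<noteq> {}"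
          unfolding second cond_event.sel by blast
      qed
      with True show ?thesis ..
    next
      case False
      have "i = 2" if "i \<in> J" for i
        using third[OF that] that zero False by metis
      with J(1) have "J = {2}"
        by blast
      then show ?thesis
        using BAHK by simp
    qed
  qed
qed

end
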